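(* Let $K\ge 1$ be an integer and $p>0$, both fixed. For every $N\ge 2$ let $\nu_N$ be the unique invariant probability measure of the Fleming-Viot process on the complete graph with $N$ particles (generator $\mathcal{L}=\mathcal{L}^{(N)}$ given in the context). Then for all $i\neq j$ in $\{1,\dots,K\}$, $$\bigl|\mathrm{Cov}_{\nu_N}(\eta(i)/N,\eta(j)/N)\bigr|\sim_N\frac{p+1}{K^2N},$$ i.e. the ratio of the two sides tends to $1$ as $N\to+\infty$.
   Context: $E=E^{(N)}=\{\eta:\{1,\dots,K\}\to\mathbb{N} : \sum_{i=1}^K\eta(i)=N\}$ with $\mathbb{N}=\{0,1,2,\dots\}$. For $\eta\in E$ with $\eta(i)\neq 0$ and $i\ne j$, $T_{i\to j}\eta$ is the configuration obtained by decreasing $\eta(i)$ by $1$ and increasing $\eta(j)$ by $1$, other coordinates unchanged; $T_{i\to i}\eta=\eta$. The generator acts on functions $f:E\to\mathbb{R}$ by $$\mathcal{L}f(\eta)=\sum_{i=1}^{K}\eta(i)\sum_{j=1}^{K}\bigl(f(T_{i\to j}\eta)-f(\eta)\bigr)\left(\frac1K+p\,\frac{\eta(j)}{N-1}\right).$$ The Markov process it generates on the finite set $E$ is irreducible, so it has a unique invariant probability measure $\nu_N$. $\mathrm{Cov}_{\nu_N}$ denotes the covariance when $\eta$ has law $\nu_N$. *)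

theory Defs
  imports "HOL-Probability.Probability" "HOL-Library.Landau_Symbols"
begin

(* Configurations are functions on the sites {1..K}; the extensional function space makes each
   of them a single HOL function, so that this set is the finite set E. *)
definition fv_states :: "nat \<Rightarrow> nat \<Rightarrow> (nat \<Rightarrow> nat) set" where
  "fv_states K N = {\<eta> \<in> {1..K} \<rightarrow>\<^sub>E UNIV. (\<Sum>i=1..K. \<eta> i) = N}"

definition fv_move :: "nat \<Rightarrow> nat \<Rightarrow> (nat \<Rightarrow> nat) \<Rightarrow> (nat \<Rightarrow> nat)" where
  "fv_move i j \<eta> = (if i = j then \<eta> else \<eta>(i := \<eta> i - 1, j := \<eta> j + 1))"

(* Functions on E are rendered by functions on all of nat => nat.  On E, the value of fv_gen only
   depends on the restriction of f to E: fv_move leaves E only if \<eta> i = 0 (truncated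
   subtraction), and then the whole i-th summand is multiplied by 0. *)
definition fv_gen ::
    "nat \<Rightarrow> nat \<Rightarrow> real \<Rightarrow> ((nat \<Rightarrow> nat) \<Rightarrow> real) \<Rightarrow> ((nat \<Rightarrow> nat) \<Rightarrow> real)" where
  "fv_gen K N p f \<eta> =
     (\<Sum>i=1..K. real (\<eta> i) *
        (\<Sum>j=1..K. (f (fv_move i j \<eta>) - f \<eta>) * (1 / real K + p * (real (\<eta> j) / (real N - 1)))))"

(* The Markov semigroup exp (t L) of the process generated by L.  On the finite set E the
   generator is a bounded operator, so the exponential series converges at every \<eta> in E. *)
definition fv_semigroup ::
    "nat \<Rightarrow> nat \<Rightarrow> real \<Rightarrow> real \<Rightarrow> ((nat \<Rightarrow> nat) \<Rightarrow> real) \<Rightarrow> ((nat \<Rightarrow> nat) \<Rightarrow> real)" where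
  "fv_semigroup K N p t f \<eta> = (\<Sum>n. t ^ n / fact n * (fv_gen K N p ^^ n) f \<eta>)"

definition fv_invariant :: "nat \<Rightarrow> nat \<Rightarrow> real \<Rightarrow> (nat \<Rightarrow> nat) pmf \<Rightarrow> bool" where
  "fv_invariant K N p \<nu> \<longleftrightarrow>
     set_pmf \<nu> \<subseteq> fv_states K N \<and>
     (\<forall>t\<ge>0. \<forall>f. measure_pmf.expectation \<nu> (fv_semigroup K N p t f) = measure_pmf.expectation \<nu> f)"

definition pmf_cov :: "'a pmf \<Rightarrow> ('a \<Rightarrow> real) \<Rightarrow> ('a \<Rightarrow> real) \<Rightarrow> real" where
  "pmf_cov M X Y = measure_pmf.expectation M
     (\<lambda>x. (X x - measure_pmf.expectation M X) * (Y x - measure_pmf.expectation M Y))"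

end

(* For distinct sites k, l the function \<eta> k - N/K is an eigenfunction of the generator, with
   eigenvalue -1, and so is a suitable combination of \<eta> k * \<eta> l, \<eta> k + \<eta> l and 1, with
   eigenvalue -2 (1 + p / (N - 1)).  The semigroup multiplies an eigenfunction by exp (- c t), so
   an eigenfunction for a nonzero eigenvalue has mean 0 under an invariant measure.  This gives
   E[\<eta> k] = N/K and E[\<eta> k * \<eta> l], hence the exact covariance
   - ((p + 1) N - 1) / (K^2 N (N - 1 + p)). *)

theory Submission
  imports Defs "HOL-Real_Asymp.Real_Asymp"
begin

section \<open>Configurations, jumps, and elementary properties of the generator\<close>

lemma finite_fv_states: "finite (fv_states K N)"
proof -
  have "fv_states K N \<subseteq> {1..K} \<rightarrow>\<^sub>E {0..N}"
  proof
    fix \<eta> assume \<eta>: "\<eta> \<in> fv_states K N"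
    have "\<eta> i \<le> N" if "i \<in> {1..K}" for i
      using \<eta> member_le_sum[of i "{1..K}" \<eta>] that by (simp add: fv_states_def)
    with \<eta> show "\<eta> \<in> {1..K} \<rightarrow>\<^sub>E {0..N}"
      by (auto simp: fv_states_def PiE_iff)
  qed
  then show ?thesis
    by (rule finite_subset) (simp add: finite_PiE)
qed

text \<open>A signed difference of indicators covers all cases at once: for \<open>i = j\<close> it
  cancels, and a positive \<open>\<eta> i\<close> makes the truncated subtraction exact.\<close>

lemma fv_move_apply:
  assumes "\<eta> i > 0"
  shows "real (fv_move i j \<eta> k) = real (\<eta> k) + (of_bool (k = j) - of_bool (k = i))"
  using assms by (auto simp: fv_move_def)

lemma fv_move_in_states:
  assumes \<eta>: "\<eta> \<in> fv_states K N" and ij: "i \<in> {1..K}" "j \<in> {1..K}" and pos: "\<eta> i > 0"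
  shows "fv_move i j \<eta> \<in> fv_states K N"
proof -
  \<comment> \<open>Conservation of mass is checked over the reals, where signed increments make
    sense; the two indicators both sum to 1.\<close>
  have "real (\<Sum>k=1..K. fv_move i j \<eta> k) = real (\<Sum>k=1..K. \<eta> k)"
    using ij by (simp add: fv_move_apply[where \<eta> = \<eta>, OF pos] sum.distrib sum_subtractf)
  then have "(\<Sum>k=1..K. fv_move i j \<eta> k) = (\<Sum>k=1..K. \<eta> k)"
    by (simp only: of_nat_eq_iff)
  with \<eta> ij show ?thesis
    by (auto simp: fv_states_def fv_move_def PiE_iff extensional_def)
qed

text \<open>From a state of E, a jump from an occupied site stays in E, and the summand of an empty
  site has the factor 0.\<close>

lemma fv_gen_cong:
  assumes "\<eta> \<in> fv_states K N" and "\<And>\<zeta>. \<zeta> \<in> fv_states K N \<Longrightarrow> f \<zeta> = g \<zeta>"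
  shows "fv_gen K N p f \<eta> = fv_gen K N p g \<eta>"
  unfolding fv_gen_def
proof (rule sum.cong[OF refl], goal_cases)
  case (1 i)
  show ?case
  proof (cases "\<eta> i = 0")
    case False
    then show ?thesis
      using assms 1 fv_move_in_states[OF assms(1)] by (auto intro!: sum.cong)
  qed simp
qed

lemma fv_gen_cmult: "fv_gen K N p (\<lambda>\<eta>. c * f \<eta>) \<eta> = c * fv_gen K N p f \<eta>"
  unfolding fv_gen_def sum_distrib_left
  by (intro sum.cong refl) (simp only: algebra_simps)

lemma fv_gen_add:
  "fv_gen K N p (\<lambda>\<eta>. f \<eta> + g \<eta>) \<eta> = fv_gen K N p f \<eta> + fv_gen K N p g \<eta>"
  unfolding fv_gen_def sum_distrib_left sum.distrib[symmetric]
  by (intro sum.cong refl) (simp only: algebra_simps)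

lemma fv_gen_const: "fv_gen K N p (\<lambda>_. c) \<eta> = 0"
  by (simp add: fv_gen_def)

section \<open>Eigenfunctions under the semigroup and an invariant measure\<close>

lemma fv_semigroup_eigenfunction:
  assumes eig: "\<And>\<eta>. \<eta> \<in> fv_states K N \<Longrightarrow> fv_gen K N p f \<eta> = c * f \<eta>"
    and \<eta>: "\<eta> \<in> fv_states K N"
  shows "fv_semigroup K N p t f \<eta> = exp (t * c) * f \<eta>"
proof -
  \<comment> \<open>The eigenvalue equation is given only on E; \<open>fv_gen_cong\<close> allows it
    to be iterated there.\<close>
  have iter: "(fv_gen K N p ^^ n) f \<zeta> = c ^ n * f \<zeta>" if "\<zeta> \<in> fv_states K N" for n \<zeta>
    using that
  proof (induction n arbitrary: \<zeta>)
    case (Suc n)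
    have "(fv_gen K N p ^^ Suc n) f \<zeta> = fv_gen K N p (\<lambda>\<eta>. c ^ n * f \<eta>) \<zeta>"
      using fv_gen_cong[OF Suc.prems Suc.IH] by simp
    also have "\<dots> = c ^ Suc n * f \<zeta>"
      using eig[OF Suc.prems] by (simp add: fv_gen_cmult)
    finally show ?case .
  qed simp
  have "(\<lambda>n. (t * c) ^ n /\<^sub>R fact n * f \<eta>) sums (exp (t * c) * f \<eta>)"
    by (intro sums_mult2 exp_converges)
  then have "(\<lambda>n. t ^ n / fact n * (fv_gen K N p ^^ n) f \<eta>) sums (exp (t * c) * f \<eta>)"
    by (simp add: iter[OF \<eta>] power_mult_distrib field_simps)
  then show ?thesis
    unfolding fv_semigroup_def by (rule sums_unique[symmetric])
qed

text \<open>At time 1, invariance says that the mean equals \<open>exp c\<close> times itself, and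
  \<open>exp c\<close> differs from 1.\<close>

lemma fv_invariant_eigenfunction:
  assumes inv: "fv_invariant K N p \<nu>"
    and eig: "\<And>\<eta>. \<eta> \<in> fv_states K N \<Longrightarrow> fv_gen K N p f \<eta> = c * f \<eta>"
    and c: "c \<noteq> 0"
  shows "measure_pmf.expectation \<nu> f = 0"
proof -
  have "measure_pmf.expectation \<nu> f = measure_pmf.expectation \<nu> (fv_semigroup K N p 1 f)"
    using inv by (simp add: fv_invariant_def)
  also have "\<dots> = measure_pmf.expectation \<nu> (\<lambda>\<eta>. exp c * f \<eta>)"
    using inv fv_semigroup_eigenfunction[OF eig, of _ 1]
    by (intro integral_cong_AE) (auto simp: AE_measure_pmf_iff fv_invariant_def)
  finally show ?thesis
    using c by simp
qed

lemma fv_invariant_integrable: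
  fixes f :: "(nat \<Rightarrow> nat) \<Rightarrow> real"
  assumes "fv_invariant K N p \<nu>"
  shows "integrable (measure_pmf \<nu>) f"
  using assms finite_subset[OF _ finite_fv_states]
  by (intro integrable_measure_pmf_finite) (auto simp: fv_invariant_def)

section \<open>The generator on coordinates and their products\<close>

context
  fixes K N :: nat and p :: real and \<eta> :: "nat \<Rightarrow> nat"
  assumes K: "K \<ge> 1" and N: "N \<ge> 2" and \<eta>: "\<eta> \<in> fv_states K N"
begin

text \<open>The rate at which each single particle jumps to \<open>j\<close>. It does not depend on
  the site being left, so the rates factorise as \<open>real (\<eta> i) * q j\<close> and the double
  sums split.\<close>

private definition q :: "nat \<Rightarrow> real" where
  "q j = 1 / real K + p * (real (\<eta> j) / (real N - 1))"

lemma sum_state: "(\<Sum>i=1..K. real (\<eta> i)) = real N"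
  using \<eta> by (simp add: fv_states_def flip: of_nat_sum)

lemma sum_q: "(\<Sum>j=1..K. q j) = 1 + p * (real N / (real N - 1))"
  using K sum_state by (simp add: q_def sum.distrib flip: sum_distrib_left sum_divide_distrib)

text \<open>The increment only matters where the jump is possible, as the rate vanishes otherwise.\<close>
lemma fv_gen_eq:
  assumes "\<And>i j. \<eta> i > 0 \<Longrightarrow> f (fv_move i j \<eta>) - f \<eta> = d i j"
  shows "fv_gen K N p f \<eta> = (\<Sum>i=1..K. \<Sum>j=1..K. real (\<eta> i) * q j * d i j)"
  unfolding fv_gen_def
proof (rule sum.cong[OF refl], goal_cases)
  case (1 i)
  show ?case
    by (cases "\<eta> i = 0") (auto simp: assms q_def sum_distrib_left intro!: sum.cong)
qed

text \<open>Total rate into \<open>k\<close>, with the null jumps from \<open>k\<close> to itself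
  included; these also occur in \<open>sum_jumps_out\<close> and cancel in the drift.\<close>

lemma sum_jumps_in:
  assumes "k \<in> {1..K}"
  shows "(\<Sum>i=1..K. \<Sum>j=1..K. real (\<eta> i) * q j * of_bool (k = j)) = real N * q k"
  using assms sum_state by (simp add: of_bool_def if_distrib cong: if_cong flip: sum_distrib_right)

lemma sum_jumps_out:
  assumes "k \<in> {1..K}"
  shows "(\<Sum>i=1..K. \<Sum>j=1..K. real (\<eta> i) * q j * of_bool (k = i))
           = real (\<eta> k) * (1 + p * (real N / (real N - 1)))"
proof -
  have "(\<Sum>i=1..K. \<Sum>j=1..K. real (\<eta> i) * q j * of_bool (k = i))
          = (\<Sum>i=1..K. of_bool (k = i) * (real (\<eta> i) * (\<Sum>j=1..K. q j)))"
    by (simp add: sum_distrib_left mult_ac)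
  also have "\<dots> = real (\<eta> k) * (\<Sum>j=1..K. q j)"
    using assms by (simp add: of_bool_def if_distrib if_distribR cong: if_cong)
  finally show ?thesis by (simp only: sum_q)
qed

lemma sum_jumps_between:
  assumes "k \<in> {1..K}" "l \<in> {1..K}"
  shows "(\<Sum>i=1..K. \<Sum>j=1..K. real (\<eta> i) * q j * (of_bool (k = i) * of_bool (l = j)))
           = real (\<eta> k) * q l"
proof -
  have "(\<Sum>i=1..K. \<Sum>j=1..K. real (\<eta> i) * q j * (of_bool (k = i) * of_bool (l = j)))
          = (\<Sum>i=1..K. \<Sum>j=1..K. if l = j then (if k = i then real (\<eta> i) * q j else 0) else 0)"
    by (intro sum.cong refl) auto
  also have "\<dots> = real (\<eta> k) * q l"
    using assms by simp
  finally show ?thesis .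
qed

text \<open>The contributions of \<open>p\<close> to inflow and outflow are equal, so only the
  uniform part of the rates drives the mean.\<close>

lemma sum_drift:
  assumes "k \<in> {1..K}"
  shows "(\<Sum>i=1..K. \<Sum>j=1..K. real (\<eta> i) * q j * (of_bool (k = j) - of_bool (k = i)))
           = real N / real K - real (\<eta> k)"
proof -
  have "(\<Sum>i=1..K. \<Sum>j=1..K. real (\<eta> i) * q j * (of_bool (k = j) - of_bool (k = i)))
          = real N * q k - real (\<eta> k) * (1 + p * (real N / (real N - 1)))"
    by (simp only: right_diff_distrib sum_subtractf sum_jumps_in[OF assms] sum_jumps_out[OF assms])
  also have "\<dots> = real N / real K - real (\<eta> k)"
    by (simp add: q_def algebra_simps)
  finally show ?thesis .
qed

lemma fv_gen_coordinate:
  assumes "k \<in> {1..K}"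
  shows "fv_gen K N p (\<lambda>\<eta>. real (\<eta> k)) \<eta> = real N / real K - real (\<eta> k)"
  by (subst fv_gen_eq[where d = "\<lambda>i j. of_bool (k = j) - of_bool (k = i)"])
     (simp_all only: fv_move_apply sum_drift[OF assms] add_diff_cancel_left')

lemma fv_gen_coordinate_product:
  assumes k: "k \<in> {1..K}" and l: "l \<in> {1..K}" and kl: "k \<noteq> l"
  shows "fv_gen K N p (\<lambda>\<eta>. real (\<eta> k) * real (\<eta> l)) \<eta>
           = (real N - 1) / real K * (real (\<eta> k) + real (\<eta> l))
             - 2 * (1 + p / (real N - 1)) * (real (\<eta> k) * real (\<eta> l))"
proof -
  define D :: "nat \<Rightarrow> nat \<Rightarrow> nat \<Rightarrow> real"
    where "D m i j = of_bool (m = j) - of_bool (m = i)" for m i j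
  \<comment> \<open>For distinct \<open>k\<close> and \<open>l\<close>, both coordinates change only
    in a jump between these two sites, with opposite signs.\<close>
  have DD: "D k i j * D l i j
              = - (of_bool (l = i) * of_bool (k = j)) - of_bool (k = i) * of_bool (l = j)" for i j
    using kl by (auto simp: D_def)
  have "fv_gen K N p (\<lambda>\<eta>. real (\<eta> k) * real (\<eta> l)) \<eta>
      = (\<Sum>i=1..K. \<Sum>j=1..K. real (\<eta> i) * q j *
           (real (\<eta> k) * D l i j + real (\<eta> l) * D k i j + D k i j * D l i j))"
    by (rule fv_gen_eq) (simp only: fv_move_apply D_def[symmetric], simp add: algebra_simps)
  also have "\<dots> = (\<Sum>i=1..K. \<Sum>j=1..K.
        real (\<eta> k) * (real (\<eta> i) * q j * D l i j) + real (\<eta> l) * (real (\<eta> i) * q j * D k i j)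
        - real (\<eta> i) * q j * (of_bool (l = i) * of_bool (k = j))
        - real (\<eta> i) * q j * (of_bool (k = i) * of_bool (l = j)))"
    by (intro sum.cong refl) (simp only: DD, simp add: algebra_simps)
  also have "\<dots> = real (\<eta> k) * (\<Sum>i=1..K. \<Sum>j=1..K. real (\<eta> i) * q j * D l i j)
        + real (\<eta> l) * (\<Sum>i=1..K. \<Sum>j=1..K. real (\<eta> i) * q j * D k i j)
        - (\<Sum>i=1..K. \<Sum>j=1..K. real (\<eta> i) * q j * (of_bool (l = i) * of_bool (k = j)))
        - (\<Sum>i=1..K. \<Sum>j=1..K. real (\<eta> i) * q j * (of_bool (k = i) * of_bool (l = j)))"
    by (simp only: sum_subtractf sum.distrib sum_distrib_left)
  also have "\<dots> = real (\<eta> k) * (real N / real K - real (\<eta> l))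
      + real (\<eta> l) * (real N / real K - real (\<eta> k)) - real (\<eta> l) * q k - real (\<eta> k) * q l"
    by (simp only: D_def sum_drift[OF k] sum_drift[OF l]
        sum_jumps_between[OF k l] sum_jumps_between[OF l k])
  \<comment> \<open>The uniform part of \<open>q k\<close> and \<open>q l\<close> turns N into N -
    1; their \<open>p\<close> part adds to the decay rate of the product.\<close>
  also have "\<dots> = (real N - 1) / real K * (real (\<eta> k) + real (\<eta> l))
      - 2 * (1 + p / (real N - 1)) * (real (\<eta> k) * real (\<eta> l))"
    by (simp add: q_def algebra_simps diff_divide_distrib add_divide_distrib)
  finally show ?thesis .
qed

end

section \<open>First and mixed moments, and the covariance\<close>

lemma fv_invariant_mean:
  assumes "K \<ge> 1" "N \<ge> 2" and inv: "fv_invariant K N p \<nu>" and k: "k \<in> {1..K}"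
  shows "measure_pmf.expectation \<nu> (\<lambda>\<eta>. real (\<eta> k)) = real N / real K"
proof -
  note int = fv_invariant_integrable[OF inv]
  \<comment> \<open>Written as a sum, so that the linearity rules for the generator apply.\<close>
  let ?f = "\<lambda>\<eta>::nat \<Rightarrow> nat. real (\<eta> k) + - (real N / real K)"
  have "measure_pmf.expectation \<nu> ?f = 0"
  proof (rule fv_invariant_eigenfunction[OF inv])
    fix \<eta> assume "\<eta> \<in> fv_states K N"
    then show "fv_gen K N p ?f \<eta> = -1 * ?f \<eta>"
      using assms by (simp only: fv_gen_add fv_gen_const fv_gen_coordinate) simp
  qed simp
  then show ?thesis
    by (simp add: int)
qed

lemma fv_invariant_mixed_moment:
  assumes KN: "K \<ge> 1" "N \<ge> 2" and p: "p > 0" and inv: "fv_invariant K N p \<nu>"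
    and k: "k \<in> {1..K}" and l: "l \<in> {1..K}" and kl: "k \<noteq> l"
  shows "measure_pmf.expectation \<nu> (\<lambda>\<eta>. real (\<eta> k) * real (\<eta> l))
           = real N * (real N - 1)\<^sup>2 / (real K ^ 2 * (real N - 1 + p))"
proof -
  note int = fv_invariant_integrable[OF inv]
  \<comment> \<open>Here \<open>- c\<close> is the eigenvalue. Comparing linear terms requires
    \<open>(real N - 1) / real K + a = c * a\<close>, and comparing constants requires
    \<open>c * b = 2 * a * real N / real K\<close>.\<close>
  define c where "c = 2 * (1 + p / (real N - 1))"
  define a where "a = (real N - 1) / (real K * (c - 1))"
  define b where "b = 2 * a * real N / (real K * c)"
  have N1: "real N - 1 > 0" and K0: "real K > 0"
    using KN by auto
  \<comment> \<open>This keeps the denominators of \<open>a\<close> and \<open>b\<close> and the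
    eigenvalue away from 0.\<close>
  have c: "c > 2"
    using N1 p by (simp add: c_def)
  let ?f = "\<lambda>\<eta>::nat \<Rightarrow> nat.
    real (\<eta> k) * real (\<eta> l) + (- a * real (\<eta> k) + (- a * real (\<eta> l) + b))"
  have a: "(real N - 1) / real K = (c - 1) * a"
    using c K0 by (simp add: a_def)
  have b: "c * b = 2 * a * (real N / real K)"
    using c K0 by (simp add: b_def)
  have "measure_pmf.expectation \<nu> ?f = 0"
  proof (rule fv_invariant_eigenfunction[OF inv])
    fix \<eta> assume "\<eta> \<in> fv_states K N"
    then have "fv_gen K N p ?f \<eta> = (c - 1) * a * (real (\<eta> k) + real (\<eta> l))
        - c * (real (\<eta> k) * real (\<eta> l)) - a * (real N / real K - real (\<eta> k))
        - a * (real N / real K - real (\<eta> l))"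
      by (simp only: fv_gen_add fv_gen_cmult fv_gen_const fv_gen_coordinate[OF KN _ k]
          fv_gen_coordinate[OF KN _ l] fv_gen_coordinate_product[OF KN _ k l kl]
          c_def[symmetric] a)
    also have "\<dots> = - c * (real (\<eta> k) * real (\<eta> l) + (- a * real (\<eta> k) + - a * real (\<eta> l)))
        - 2 * a * (real N / real K)"
      by (simp add: algebra_simps)
    also have "\<dots> = - c * ?f \<eta>"
      unfolding b[symmetric] by (simp add: algebra_simps)
    finally show "fv_gen K N p ?f \<eta> = - c * ?f \<eta>" .
  qed (use c in simp)
  then have "measure_pmf.expectation \<nu> (\<lambda>\<eta>. real (\<eta> k) * real (\<eta> l))
      = 2 * a * (real N / real K) - b"
    by (simp add: int fv_invariant_mean[OF KN inv k] fv_invariant_mean[OF KN inv l])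
  \<comment> \<open>In this form the factor \<open>c - 1\<close> cancels the denominator of
    \<open>a\<close> contained in \<open>b\<close>.\<close>
  also have "\<dots> = (c - 1) * b"
    unfolding b[symmetric] by (simp add: algebra_simps)
  also have "\<dots> = 2 * real N / (real K * c) * ((c - 1) * a)"
    by (simp add: b_def)
  also have "\<dots> = real N * (real N - 1) / (real K ^ 2 * (c / 2))"
    unfolding a[symmetric] by (simp add: power2_eq_square mult_ac)
  also have "c / 2 = (real N - 1 + p) / (real N - 1)"
    using N1 by (simp add: c_def field_simps)
  finally show ?thesis
    by (simp add: power2_eq_square mult.assoc)
qed

text \<open>Subtracting the product of the means leaves the numerator (N - 1)^2 - N (N - 1 + p) = 1
  - (p + 1) N.\<close>

lemma fv_invariant_cov:
  assumes KN: "K \<ge> 1" "N \<ge> 2" and p: "p > 0" and inv: "fv_invariant K N p \<nu>"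
    and k: "k \<in> {1..K}" and l: "l \<in> {1..K}" and kl: "k \<noteq> l"
  shows "pmf_cov \<nu> (\<lambda>\<eta>. real (\<eta> k) / real N) (\<lambda>\<eta>. real (\<eta> l) / real N)
           = - (((p + 1) * real N - 1) / (real K ^ 2 * real N * (real N - 1 + p)))"
proof -
  note int = fv_invariant_integrable[OF inv]
  have pos: "real N - 1 + p > 0" "real K > 0" "real N > 0"
    using KN p by auto
  have mean: "measure_pmf.expectation \<nu> (\<lambda>\<eta>. real (\<eta> m) / real N) = 1 / real K"
    if "m \<in> {1..K}" for m
    using fv_invariant_mean[OF KN inv that] pos by (simp add: int)
  have "pmf_cov \<nu> (\<lambda>\<eta>. real (\<eta> k) / real N) (\<lambda>\<eta>. real (\<eta> l) / real N)
     = measure_pmf.expectation \<nu> (\<lambda>\<eta>. real (\<eta> k) * real (\<eta> l) / real N ^ 2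
         - 1 / real K * (real (\<eta> k) / real N) - 1 / real K * (real (\<eta> l) / real N)
         + 1 / real K ^ 2)"
    unfolding pmf_cov_def mean[OF k] mean[OF l]
    by (intro Bochner_Integration.integral_cong refl) (simp add: algebra_simps power2_eq_square)
  also have "\<dots> = measure_pmf.expectation \<nu> (\<lambda>\<eta>. real (\<eta> k) * real (\<eta> l)) / real N ^ 2
      - 1 / real K ^ 2"
    using pos
    by (simp add: int fv_invariant_mean[OF KN inv k] fv_invariant_mean[OF KN inv l] power2_eq_square)
  also have "\<dots> = - (((p + 1) * real N - 1) / (real K ^ 2 * real N * (real N - 1 + p)))"
    unfolding fv_invariant_mixed_moment[OF KN p inv k l kl]
    using pos by (simp add: divide_simps) (simp add: algebra_simps power2_eq_square)
  finally show ?thesis .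
qed

section \<open>Asymptotics of the exact covariance\<close>

theorem theorem2p7:
  fixes K :: nat and p :: real and \<nu> :: "nat \<Rightarrow> (nat \<Rightarrow> nat) pmf" and i j :: nat
  assumes "K \<ge> 1" and "p > 0"
    and "\<And>N. N \<ge> 2 \<Longrightarrow> fv_invariant K N p (\<nu> N)"
    and "i \<in> {1..K}" and "j \<in> {1..K}" and "i \<noteq> j"
  shows "(\<lambda>N. \<bar>pmf_cov (\<nu> N) (\<lambda>\<eta>. real (\<eta> i) / real N) (\<lambda>\<eta>. real (\<eta> j) / real N)\<bar>)
           \<sim>[sequentially] (\<lambda>N. (p + 1) / (real K ^ 2 * real N))"
proof -
  have K0: "real K > 0"
    using assms(1) by simp
  have abs_cov: "\<bar>pmf_cov (\<nu> N) (\<lambda>\<eta>. real (\<eta> i) / real N) (\<lambda>\<eta>. real (\<eta> j) / real N)\<bar>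
      = ((p + 1) * real N - 1) / (real K ^ 2 * real N * (real N - 1 + p))" if N: "N \<ge> 2" for N
  proof -
    \<comment> \<open>The numerator is nonnegative, so the absolute value just removes the minus
      sign.\<close>
    have "(p + 1) * real N \<ge> 1 * 1"
      using N assms(2) by (intro mult_mono) auto
    with N assms(2) show ?thesis
      unfolding fv_invariant_cov[OF assms(1) N assms(2) assms(3)[OF N] assms(4-6)]
      by simp
  qed
  have "(\<lambda>N. \<bar>pmf_cov (\<nu> N) (\<lambda>\<eta>. real (\<eta> i) / real N) (\<lambda>\<eta>. real (\<eta> j) / real N)\<bar>)
      \<sim>[sequentially] (\<lambda>N. ((p + 1) * real N - 1) / (real K ^ 2 * real N * (real N - 1 + p)))"
    by (intro asymp_equiv_refl_ev eventually_mono[OF eventually_ge_at_top[of 2]] abs_cov)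
  also have "(\<lambda>N. ((p + 1) * real N - 1) / (real K ^ 2 * real N * (real N - 1 + p)))
      \<sim>[sequentially] (\<lambda>N. (p + 1) / (real K ^ 2 * real N))"
    \<comment> \<open>The ratio is ((p + 1) N - 1) / ((p + 1) (N - 1 + p)), which tends to
      1.\<close>
    using K0 assms(2) by real_asymp
  finally show ?thesis .
qed

end
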